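(* Let $n\ge2$, let $\pi(n)$ be a finite projective plane of order $n$, and let $N=n^2+n+1$. For any positive integers $r_1\ge r_2\ge\dots\ge r_N$, $$\mathrm{def}_c(Erd(r_1,\dots,r_N))\ge \frac{1}{10}\left(\sum_{i=n+2}^{N}r_i-9\sum_{i=1}^{n+1}r_i+9\right).$$
   Context: All graphs are finite, simple and undirected. A finite projective plane $\pi(n)$ of order $n\ge2$ has $N=n^2+n+1$ points and $N$ lines (each line a set of points) such that any two points lie on a unique common line, any two lines share a unique point, every point lies on $n+1$ lines, and every line contains $n+1$ points. Identify the points with $\{1,\dots,N\}$ and enumerate the lines as $l_1,\dots,l_N$. For positive integers $r_1,\dots,r_N$, the graph $Erd(r_1,\dots,r_N)$ has vertex set $\{u\}\cup\{1,\dots,N\}\cup\{v^{(l_i)}_1,\dots,v^{(l_i)}_{r_i}:1\le i\le N\}$ and edges $uv^{(l_i)}_j$ for all $1\le i\le N$, $1\le j\le r_i$, together with $v^{(l_i)}_jk$ for all $1\le i\le N$, $1\le j\le r_i$ and every point $k\in l_i$. A set $A\subseteq\{1,\dots,t\}$ is a cyclic interval modulo $t$ if $A$ or $\{1,\dots,t\}\setminus A$ is an interval of integers; a cyclic interval $t$-coloring is a proper edge coloring with colors $1,\dots,t$ in which the set of colors at every vertex is a cyclic interval modulo $t$. The cyclic deficiency $\mathrm{def}_c(G)$ is the minimum number of pendant edges whose attachment to $G$ yields a graph admitting a cyclic interval coloring. *)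

theory Defs
  imports Complex_Main
begin

record 'a ugraph =
  verts :: "'a set"
  edges :: "'a set set"

definition simple_graph :: "'a ugraph \<Rightarrow> bool" where
  "simple_graph G \<longleftrightarrow> finite (verts G) \<and> (\<forall>e\<in>edges G. e \<subseteq> verts G \<and> card e = 2)"

definition proper_edge_coloring :: "'a ugraph \<Rightarrow> nat \<Rightarrow> ('a set \<Rightarrow> nat) \<Rightarrow> bool" where
  "proper_edge_coloring G t c \<longleftrightarrow>
     (\<forall>e\<in>edges G. c e \<in> {1..t}) \<and>
     (\<forall>e\<in>edges G. \<forall>f\<in>edges G. e \<noteq> f \<and> e \<inter> f \<noteq> {} \<longrightarrow> c e \<noteq> c f)"

definition colors_at :: "'a ugraph \<Rightarrow> ('a set \<Rightarrow> nat) \<Rightarrow> 'a \<Rightarrow> nat set" where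
  "colors_at G c v = c ` {e \<in> edges G. v \<in> e}"

(* The empty set counts as an interval, so {1..t} itself is a cyclic interval modulo t. *)
definition cyclic_interval :: "nat \<Rightarrow> nat set \<Rightarrow> bool" where
  "cyclic_interval t A \<longleftrightarrow>
     A \<subseteq> {1..t} \<and> ((\<exists>a b. A = {a..b}) \<or> (\<exists>a b. {1..t} - A = {a..b}))"

(* Not every color in {1..t} is required to occur. *)
definition cyclic_interval_coloring :: "'a ugraph \<Rightarrow> nat \<Rightarrow> ('a set \<Rightarrow> nat) \<Rightarrow> bool" where
  "cyclic_interval_coloring G t c \<longleftrightarrow>
     proper_edge_coloring G t c \<and> (\<forall>v\<in>verts G. cyclic_interval t (colors_at G c v))"

(* Attaches k pendant edges, the i-th one joining the vertex a i of G to a new leaf.  The leaves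
   are tagged with Inr, so they are new even when the vertex type of G is finite; several edges
   may be attached to the same vertex. *)
definition attach_pendant :: "'a ugraph \<Rightarrow> nat \<Rightarrow> (nat \<Rightarrow> 'a) \<Rightarrow> ('a + nat) ugraph" where
  "attach_pendant G k a =
     \<lparr> verts = Inl ` verts G \<union> Inr ` {..<k},
       edges = (`) Inl ` edges G \<union> {{Inl (a i), Inr i} |i. i < k} \<rparr>"

(* For simple graphs the minimum is attained, see pendant_completion below. *)
definition cyclic_deficiency :: "'a ugraph \<Rightarrow> nat" where
  "cyclic_deficiency G =
     (LEAST k. \<exists>a. (\<forall>i<k. a i \<in> verts G) \<and>
        (\<exists>t c. cyclic_interval_coloring (attach_pendant G k a) t c))"

definition projective_plane :: "nat \<Rightarrow> 'p set \<Rightarrow> 'p set set \<Rightarrow> bool" where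
  "projective_plane n P L \<longleftrightarrow>
     n \<ge> 2 \<and> card P = n^2 + n + 1 \<and> card L = n^2 + n + 1 \<and>
     (\<forall>A\<in>L. A \<subseteq> P) \<and>
     (\<forall>p\<in>P. \<forall>q\<in>P. p \<noteq> q \<longrightarrow> (\<exists>!A. A \<in> L \<and> p \<in> A \<and> q \<in> A)) \<and>
     (\<forall>A\<in>L. \<forall>B\<in>L. A \<noteq> B \<longrightarrow> (\<exists>!p. p \<in> A \<and> p \<in> B)) \<and>
     (\<forall>p\<in>P. card {A \<in> L. p \<in> A} = n + 1) \<and>
     (\<forall>A\<in>L. card A = n + 1)"

(* Line_Vertex i j is the j-th vertex belonging to the i-th line. *)
datatype erd_vertex = Apex | Point nat | Line_Vertex nat nat

definition Erd :: "nat \<Rightarrow> (nat \<Rightarrow> nat set) \<Rightarrow> (nat \<Rightarrow> nat) \<Rightarrow> erd_vertex ugraph" where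
  "Erd N l r =
     \<lparr> verts = {Apex} \<union> Point ` {1..N} \<union>
                {Line_Vertex i j |i j. i \<in> {1..N} \<and> j \<in> {1..r i}},
       edges = {{Apex, Line_Vertex i j} |i j. i \<in> {1..N} \<and> j \<in> {1..r i}} \<union>
                {{Line_Vertex i j, Point k} |i j k. i \<in> {1..N} \<and> j \<in> {1..r i} \<and> k \<in> l i} \<rparr>"

lemma simple_graph_Erd:
  assumes "\<And>i. i \<in> {1..N} \<Longrightarrow> l i \<subseteq> {1..N}"
  shows "simple_graph (Erd N l r)"
proof -
  have "{Line_Vertex i j |i j. i \<in> {1..N} \<and> j \<in> {1..r i}} =
        (\<lambda>(i, j). Line_Vertex i j) ` (SIGMA i:{1..N}. {1..r i})"
    by auto
  then have "finite (verts (Erd N l r))"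
    by (simp add: Erd_def)
  then show ?thesis
    using assms by (fastforce simp: simple_graph_def Erd_def)
qed

lemma simple_graph_attach_pendant:
  assumes "simple_graph G" and "\<And>i. i < k \<Longrightarrow> a i \<in> verts G"
  shows "simple_graph (attach_pendant G k a)"
  using assms by (fastforce simp: simple_graph_def attach_pendant_def card_image)

lemma pendant_completion:
  assumes G: "simple_graph G"
  shows "\<exists>k a. (\<forall>i<k. a i \<in> verts G) \<and>
           (\<exists>t c. cyclic_interval_coloring (attach_pendant G k a) t c)"
proof -
  have finE: "finite (edges G)"
    using G by (auto simp: simple_graph_def intro: finite_subset[of _ "Pow (verts G)"])
  define m where "m = card (edges G)"
  obtain c where c: "bij_betw c (edges G) {1..m}"
    using finE unfolding m_def by (metis finite_same_card_bij finite_atLeastAtMost card_atLeastAtMost diff_Suc_1)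
  define S where "S = (SIGMA v:verts G. {1..m} - colors_at G c v)"
  have "finite S"
    using G by (auto simp: S_def simple_graph_def)
  then obtain h where h: "bij_betw h {..<card S} S"
    using ex_bij_betw_nat_finite lessThan_atLeast0 by metis
  define k where "k = card S"
  define a where "a = fst \<circ> h"
  define d where "d e = (if \<exists>i. Inr i \<in> e then snd (h (THE i. Inr i \<in> e)) else c (Inl -` e))"
    for e :: "('a + nat) set"
  define H where "H = attach_pendant G k a"
  have hS: "h i \<in> S" if "i < k" for i
    using h that by (auto simp: k_def bij_betw_def)
  have d_old: "d (Inl ` e) = c e" for e
    by (auto simp: d_def inj_vimage_image_eq)
  have d_new: "d {Inl (a i), Inr i} = snd (h i)" for i
  proof -
    have "(THE j. Inr j \<in> {Inl (a i), Inr i}) = i" by auto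
    then show ?thesis by (auto simp: d_def)
  qed
  have edgesH: "edges H = (`) Inl ` edges G \<union> {{Inl (a i), Inr i} |i. i < k}"
    and vertsH: "verts H = Inl ` verts G \<union> Inr ` {..<k}"
    by (simp_all add: H_def attach_pendant_def)
  have aV: "a i \<in> verts G" if "i < k" for i
    using hS[OF that] by (auto simp: S_def a_def)
  have sh: "snd (h i) \<in> {1..m}" "snd (h i) \<notin> colors_at G c (a i)" if "i < k" for i
    using hS[OF that] by (auto simp: S_def a_def)
  have hinj: "i = j" if "i < k" "j < k" "a i = a j" "snd (h i) = snd (h j)" for i j
    using h that by (auto simp: bij_betw_def inj_on_def k_def a_def prod_eq_iff)
  have cm: "c e \<in> {1..m}" if "e \<in> edges G" for e
    using c that by (auto simp: bij_betw_def)
  have oo: "d (Inl ` e) \<noteq> d (Inl ` f)"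
    if "e \<in> edges G" "f \<in> edges G" "Inl ` e \<noteq> (Inl ` f :: ('a + nat) set)" for e f
    using that c unfolding d_old by (auto simp: bij_betw_def inj_on_def)
  have on: "d (Inl ` e) \<noteq> d {Inl (a i), Inr i}"
    if "e \<in> edges G" "i < k" "Inl ` e \<inter> {Inl (a i), Inr i :: 'a + nat} \<noteq> {}" for e i
  proof -
    have "a i \<in> e" using that(3) by auto
    then have "c e \<in> colors_at G c (a i)" using that(1) by (auto simp: colors_at_def)
    then show ?thesis using sh(2)[OF that(2)] unfolding d_old d_new by auto
  qed
  have nn: "d {Inl (a i), Inr i} \<noteq> d {Inl (a j), Inr j}"
    if "i < k" "j < k" "{Inl (a i), Inr i} \<noteq> {Inl (a j), Inr j :: 'a + nat}"
      "{Inl (a i), Inr i} \<inter> {Inl (a j), Inr j :: 'a + nat} \<noteq> {}" for i j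
  proof -
    have "a i = a j" using that(3,4) by blast
    then show ?thesis using that(3) hinj[OF that(1,2)] unfolding d_new by metis
  qed
  have "proper_edge_coloring H m d"
    unfolding proper_edge_coloring_def
  proof (intro conjI ballI impI)
    fix e assume "e \<in> edges H"
    then show "d e \<in> {1..m}"
      unfolding edgesH using cm sh(1) d_old d_new by auto
  next
    fix e f assume e: "e \<in> edges H" and f: "f \<in> edges H" and ef: "e \<noteq> f \<and> e \<inter> f \<noteq> {}"
    consider e' where "e' \<in> edges G" "e = Inl ` e'" | i where "i < k" "e = {Inl (a i), Inr i}"
      using e unfolding edgesH by blast
    note e_cases = this
    consider f' where "f' \<in> edges G" "f = Inl ` f'" | i where "i < k" "f = {Inl (a i), Inr i}"
      using f unfolding edgesH by blast
    note f_cases = this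
    show "d e \<noteq> d f"
    proof (cases rule: e_cases)
      case e': 1
      show ?thesis
      proof (cases rule: f_cases)
        case 1
        then show ?thesis using e' ef oo by simp
      next
        case 2
        then show ?thesis using e' ef on by simp
      qed
    next
      case i: (2 i)
      show ?thesis
      proof (cases rule: f_cases)
        case (1 f')
        then have "d f \<noteq> d e" using i ef on[of f' i] by (simp add: Int_commute)
        then show ?thesis by simp
      next
        case (2 j)
        then show ?thesis using i ef nn[of i j] by simp
      qed
    qed
  qed
  moreover have "colors_at H d (Inl v) = {1..m}" if v: "v \<in> verts G" for v
  proof (intro equalityI subsetI)
    fix x assume "x \<in> colors_at H d (Inl v)"
    with \<open>proper_edge_coloring H m d\<close> show "x \<in> {1..m}"
      by (auto simp: colors_at_def proper_edge_coloring_def)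
  next
    fix x assume x: "x \<in> {1..m}"
    show "x \<in> colors_at H d (Inl v)"
    proof (cases "x \<in> colors_at G c v")
      case True
      then obtain e where "e \<in> edges G" "v \<in> e" "x = c e"
        by (auto simp: colors_at_def)
      then show ?thesis
        unfolding colors_at_def edgesH by (intro image_eqI[of _ _ "Inl ` e"]) (auto simp: d_old)
    next
      case False
      with x v have "(v, x) \<in> S" by (auto simp: S_def)
      then obtain i where "i < k" "h i = (v, x)"
        using h by (metis bij_betw_iff_bijections k_def lessThan_iff)
      then show ?thesis
        unfolding colors_at_def edgesH
        by (intro image_eqI[of _ _ "{Inl (a i), Inr i}"]) (auto simp: d_new, auto simp: a_def)
    qed
  qed
  moreover have "colors_at H d (Inr i) = {snd (h i)}" if "i < k" for i
  proof -
    have "{e \<in> edges H. Inr i \<in> e} = {{Inl (a i), Inr i}}"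
      using that unfolding edgesH by auto
    then show ?thesis by (simp add: colors_at_def d_new)
  qed
  moreover have "cyclic_interval m {1..m}" by (auto simp: cyclic_interval_def)
  moreover have "cyclic_interval m {snd (h i)}" if "i < k" for i
    using sh(1)[OF that] unfolding cyclic_interval_def
    by (metis atLeastAtMost_singleton empty_subsetI insert_subset)
  ultimately have "cyclic_interval_coloring H m d"
    unfolding cyclic_interval_coloring_def vertsH by auto
  then show ?thesis
    using aV unfolding H_def by blast
qed

end

theory Submission
  imports Defs
begin

text \<open>
  Let \<open>R\<close> be the sum of all \<open>r i\<close> and \<open>S\<close> the sum of the \<open>n + 1\<close> largest ones. Any two of the
  \<open>R\<close> edges at the apex \<open>u\<close> lie on a closed walk \<open>u, v, p, v', u\<close>, because two lines share a point
  \<open>p\<close>. Walking along it changes the color, measured cyclically, by less than the degree at each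
  of \<open>v\<close>, \<open>p\<close> and \<open>v'\<close>, so after attaching \<open>k\<close> pendant edges all colors of these edges have
  cyclic distance at most \<open>D = 2 (n + 1) + (S - 1) + k \<le> 3 S - 1 + k\<close> from a fixed one.
  A cyclic ball of radius \<open>D\<close> has at most \<open>2 D + 1\<close> elements, hence \<open>R \<le> 2 D + 1\<close>;
  since \<open>S \<ge> n + 1 \<ge> 3\<close>, this is at most \<open>10 (S + k) - 9\<close>.
\<close>

section \<open>Cyclic distance between colors\<close>

text \<open>For colors in \<open>{1..t}\<close>, the shorter of the two arcs between
  \<open>x\<close> and \<open>y\<close> on a cycle of length \<open>t\<close> has length at most
  \<open>d\<close>. Working in \<open>int\<close> avoids truncated differences.\<close>

definition cyclically_near :: "nat \<Rightarrow> nat \<Rightarrow> nat \<Rightarrow> nat \<Rightarrow> bool" where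
  "cyclically_near t d x y \<longleftrightarrow>
     \<bar>int x - int y\<bar> \<le> int d \<or> int t - \<bar>int x - int y\<bar> \<le> int d"

text \<open>If at most one of the two steps wraps around, a triangle inequality suffices. If both
  do, the bound \<open>2 * int t\<close> on the sum of the three distances, which is twice the span
  of the three points, makes the direct distance from \<open>x\<close> to \<open>z\<close>
  small.\<close>

lemma cyclically_near_trans:
  assumes "cyclically_near t d x y" "cyclically_near t e y z"
    and "x \<in> {1..t}" "y \<in> {1..t}" "z \<in> {1..t}"
  shows "cyclically_near t (d + e) x z"
proof -
  have "\<bar>int x - int z\<bar> \<le> \<bar>int x - int y\<bar> + \<bar>int y - int z\<bar>"
    "\<bar>int x - int y\<bar> \<le> \<bar>int x - int z\<bar> + \<bar>int y - int z\<bar>"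
    "\<bar>int y - int z\<bar> \<le> \<bar>int x - int z\<bar> + \<bar>int x - int y\<bar>"
    by simp_all
  moreover have "\<bar>int x - int y\<bar> + \<bar>int y - int z\<bar> + \<bar>int x - int z\<bar> \<le> 2 * int t"
    using assms(3-5) by auto
  ultimately show ?thesis
    using assms(1,2) unfolding cyclically_near_def of_nat_add by linarith
qed

lemma cyclically_near_mono:
  "cyclically_near t d x y \<Longrightarrow> d \<le> e \<Longrightarrow> cyclically_near t e x y"
  unfolding cyclically_near_def by auto

lemma card_cyclic_ball:
  assumes x: "x \<in> {1..t}"
  shows "card {y \<in> {1..t}. cyclically_near t d x y} \<le> 2 * d + 1"
proof -
  \<comment> \<open>\<open>?f j\<close> moves \<open>x\<close> by \<open>j\<close> steps around the
    cycle; \<open>- 1\<close> and \<open>+ 1\<close> put the residues into \<open>{1..t}\<close>.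
    The offsets from \<open>- int d\<close> to \<open>int d\<close> cover the ball, possibly with
    repetitions.\<close>
  let ?f = "\<lambda>j. nat ((int x + j - 1) mod int t + 1)"
  have "y \<in> ?f ` {- int d..int d}" if y: "y \<in> {1..t}" and near: "cyclically_near t d x y" for y
  proof -
    have ym: "nat ((int y - 1) mod int t + 1) = y"
      using y by (simp add: mod_pos_pos_trivial)
    consider "\<bar>int x - int y\<bar> \<le> int d" | "int y - int x \<ge> int t - int d"
      | "int x - int y \<ge> int t - int d"
      using near unfolding cyclically_near_def by linarith
    then show ?thesis
    proof cases
      case 1
      then show ?thesis
        using ym by (intro image_eqI[of _ _ "int y - int x"]) auto
    next
      case 2
      have "(int x + (int y - int x - int t) - 1) mod int t = (int y - 1 - int t) mod int t"
        by (simp add: algebra_simps)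
      also have "\<dots> = (int y - 1) mod int t" by simp
      finally show ?thesis
        using ym 2 x y by (intro image_eqI[of _ _ "int y - int x - int t"]) auto
    next
      case 3
      have "(int x + (int y - int x + int t) - 1) mod int t = (int y - 1 + int t) mod int t"
        by (simp add: algebra_simps)
      also have "\<dots> = (int y - 1) mod int t" by simp
      finally show ?thesis
        using ym 3 x y by (intro image_eqI[of _ _ "int y - int x + int t"]) auto
    qed
  qed
  then have "{y \<in> {1..t}. cyclically_near t d x y} \<subseteq> ?f ` {- int d..int d}"
    by blast
  then have "card {y \<in> {1..t}. cyclically_near t d x y} \<le> card {- int d..int d}"
    by (rule surj_card_le[rotated]) simp
  then show ?thesis by simp
qed

text \<open>Two elements of \<open>A\<close> are joined by a path around the cycle that stays inside
  \<open>A\<close>, hence has at most \<open>card A - 1\<close> steps. If the complement is an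
  interval separating them, this path passes between \<open>t\<close> and \<open>1\<close>.\<close>

lemma cyclic_interval_near:
  assumes A: "cyclic_interval t A" and x: "x \<in> A" and y: "y \<in> A"
  shows "cyclically_near t (card A - 1) x y"
proof -
  have At: "A \<subseteq> {1..t}" using A by (simp add: cyclic_interval_def)
  consider a b where "A = {a..b}" | a b where "{1..t} - A = {a..b}" "a \<le> b"
  proof -
    \<comment> \<open>An empty complement is moved to the first case, so that the second has
      \<open>a \<le> b\<close> and a gap of size exactly \<open>b - a + 1\<close>.\<close>
    have "A = {1..t}" if "{1..t} - A = {}" using that At by blast
    then show thesis
      using A that unfolding cyclic_interval_def
      by (metis atLeastatMost_empty_iff)
  qed
  then show ?thesis
  proof cases
    case 1
    then show ?thesis using x y unfolding cyclically_near_def by auto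
  next
    case (2 a b)
    have fin: "finite A" using At finite_subset by blast
    have "card ({1..t} - A) = t - card A" using At fin by (simp add: card_Diff_subset)
    moreover have "card A \<le> t" using At card_mono[of "{1..t}" A] by simp
    ultimately have cA: "int (card A) = int t - (int b - int a + 1)"
      using 2 by simp
    have "a \<in> {1..t} - A" "b \<in> {1..t} - A" using 2 by auto
    then have ab: "1 \<le> a" "b \<le> t" by auto
    have "x \<notin> {a..b}" "y \<notin> {a..b}" using x y 2 by blast+
    then have xy: "x < a \<or> b < x" "y < a \<or> b < y" by auto
    have "x \<in> {1..t}" "y \<in> {1..t}" using x y At by auto
    moreover have "card A \<ge> 1" using x fin by (metis One_nat_def Suc_leI card_gt_0_iff empty_iff)
    ultimately show ?thesis
      using cA ab xy 2(2) unfolding cyclically_near_def by auto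
  qed
qed

section \<open>Degrees and color spread after attaching pendant edges\<close>

lemma colors_at_card_le:
  assumes "finite (edges G)"
  shows "card (colors_at G c v) \<le> card {e \<in> edges G. v \<in> e}"
  unfolding colors_at_def using assms by (intro card_image_le) simp

lemma finite_edges_simple_graph: "simple_graph G \<Longrightarrow> finite (edges G)"
  by (auto simp: simple_graph_def intro: finite_subset[of _ "Pow (verts G)"])

lemma degree_attach_pendant:
  assumes "finite (edges G)"
  shows "card {e \<in> edges (attach_pendant G k a). Inl v \<in> e}
           \<le> card {e \<in> edges G. v \<in> e} + card {i. i < k \<and> a i = v}"
proof -
  have "{e \<in> edges (attach_pendant G k a). Inl v \<in> e} \<subseteq>
      (`) Inl ` {e \<in> edges G. v \<in> e} \<union> (\<lambda>i. {Inl (a i), Inr i}) ` {i. i < k \<and> a i = v}"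
    by (auto simp: attach_pendant_def)
  then have "card {e \<in> edges (attach_pendant G k a). Inl v \<in> e} \<le>
      card ((`) Inl ` {e \<in> edges G. v \<in> e} \<union> (\<lambda>i. {Inl (a i), Inr i}) ` {i. i < k \<and> a i = v})"
    using assms by (intro card_mono) auto
  also have "\<dots> \<le> card ((`) Inl ` {e \<in> edges G. v \<in> e} :: ('a + nat) set set) +
      card ((\<lambda>i. {Inl (a i), Inr i}) ` {i. i < k \<and> a i = v})"
    by (rule card_Un_le)
  also have "\<dots> \<le> card {e \<in> edges G. v \<in> e} + card {i. i < k \<and> a i = v}"
    using assms by (intro add_mono card_image_le) auto
  finally show ?thesis .
qed

text \<open>This is one corner of the walk. The pendant edges at \<open>v\<close> are counted apart
  from the degree in \<open>G\<close>, so that their numbers can be added up over the whole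
  walk.\<close>

lemma cyclic_interval_coloring_attach_near:
  assumes G: "simple_graph G"
    and col: "cyclic_interval_coloring (attach_pendant G k a) t c"
    and e: "e \<in> edges G" "v \<in> e" and f: "f \<in> edges G" "v \<in> f"
  shows "cyclically_near t (card {g \<in> edges G. v \<in> g} + card {i. i < k \<and> a i = v} - 1)
           (c (Inl ` e)) (c (Inl ` f))"
proof -
  let ?H = "attach_pendant G k a"
  have fin: "finite (edges G)" using G by (rule finite_edges_simple_graph)
  then have "finite (edges ?H)" by (auto simp: attach_pendant_def)
  from colors_at_card_le[OF this] degree_attach_pendant[OF fin]
  have "card (colors_at ?H c (Inl v))
      \<le> card {g \<in> edges G. v \<in> g} + card {i. i < k \<and> a i = v}"
    by (rule order_trans)
  moreover have "v \<in> verts G" using G e by (auto simp: simple_graph_def)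
  then have "cyclic_interval t (colors_at ?H c (Inl v))"
    using col by (auto simp: cyclic_interval_coloring_def attach_pendant_def)
  moreover have "c (Inl ` g) \<in> colors_at ?H c (Inl v)" if "g \<in> edges G" "v \<in> g" for g
    using that by (auto simp: colors_at_def attach_pendant_def)
  ultimately show ?thesis
    using e f by (blast intro: cyclically_near_mono[OF cyclic_interval_near] diff_le_mono)
qed

section \<open>Sums of the largest multiplicities and degrees in the Erd graph\<close>

text \<open>Induction by removing the largest index: since \<open>A\<close> lies in
  \<open>{1..Max A}\<close>, that index is at least \<open>card A\<close>, so its value is at most
  \<open>r (card A)\<close>.\<close>

lemma sum_le_sum_initial:
  fixes r :: "nat \<Rightarrow> nat"
  assumes "\<And>i j. 1 \<le> i \<Longrightarrow> i \<le> j \<Longrightarrow> j \<le> N \<Longrightarrow> r j \<le> r i"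
    and "A \<subseteq> {1..N}"
  shows "sum r A \<le> sum r {1..card A}"
  using assms(2)
proof (induction "card A" arbitrary: A)
  case 0
  then have "A = {}" using finite_subset by fastforce
  then show ?case by simp
next
  case (Suc m)
  have fin: "finite A" using Suc.prems finite_subset by blast
  have ne: "A \<noteq> {}" using Suc.hyps(2) by auto
  let ?M = "Max A"
  have M: "?M \<in> A" using fin ne by simp
  have "A \<subseteq> {1..?M}" using Suc.prems fin by auto
  then have "card A \<le> ?M" using card_mono[of "{1..?M}" A] by simp
  then have "r ?M \<le> r (Suc m)"
    using assms(1)[of "Suc m" ?M] M Suc.prems Suc.hyps(2) by auto
  moreover have "m = card (A - {?M})"
    using Suc.hyps(2) M fin by simp
  then have "sum r (A - {?M}) \<le> sum r {1..m}"
    using Suc.hyps(1)[of "A - {?M}"] Suc.prems by blast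
  moreover have "sum r A = r ?M + sum r (A - {?M})"
    using fin M by (rule sum.remove)
  ultimately show ?case using Suc.hyps(2)[symmetric] by simp
qed

lemma degree_Line_Vertex:
  assumes "i \<in> {1..N}" "finite (l i)"
  shows "card {e \<in> edges (Erd N l r). Line_Vertex i j \<in> e} \<le> card (l i) + 1"
proof -
  have "{e \<in> edges (Erd N l r). Line_Vertex i j \<in> e} \<subseteq>
      insert {Apex, Line_Vertex i j} ((\<lambda>k. {Line_Vertex i j, Point k}) ` l i)"
    by (auto simp: Erd_def)
  then have "card {e \<in> edges (Erd N l r). Line_Vertex i j \<in> e} \<le>
      card (insert {Apex, Line_Vertex i j} ((\<lambda>k. {Line_Vertex i j, Point k}) ` l i))"
    using assms by (intro card_mono) auto
  also have "\<dots> \<le> Suc (card ((\<lambda>k. {Line_Vertex i j, Point k}) ` l i))"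
    using assms by (simp add: card_insert_le_m1 card_insert_if)
  also have "\<dots> \<le> Suc (card (l i))"
    using assms by (simp add: card_image_le)
  finally show ?thesis by simp
qed

lemma degree_Point:
  "card {e \<in> edges (Erd N l r). Point p \<in> e} \<le> (\<Sum>i | i \<in> {1..N} \<and> p \<in> l i. r i)"
proof -
  let ?I = "SIGMA i:{i. i \<in> {1..N} \<and> p \<in> l i}. {1..r i}"
  have fin: "finite ?I" by (intro finite_SigmaI) auto
  have "{e \<in> edges (Erd N l r). Point p \<in> e} \<subseteq> (\<lambda>(i, j). {Line_Vertex i j, Point p}) ` ?I"
    by (auto simp: Erd_def)
  then have "card {e \<in> edges (Erd N l r). Point p \<in> e} \<le> card ?I"
    by (rule surj_card_le[OF fin])
  also have "\<dots> = (\<Sum>i | i \<in> {1..N} \<and> p \<in> l i. r i)" by simp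
  finally show ?thesis .
qed

section \<open>Color spread at the apex\<close>

lemma Erd_coloring_bound:
  assumes plane: "projective_plane n {1..N} L" and l: "bij_betw l {1..N} L"
    and pos: "\<And>i. i \<in> {1..N} \<Longrightarrow> r i > 0"
    and mono: "\<And>i j. 1 \<le> i \<Longrightarrow> i \<le> j \<Longrightarrow> j \<le> N \<Longrightarrow> r j \<le> r i"
    and col: "cyclic_interval_coloring (attach_pendant (Erd N l r) k a) t c"
  shows "sum r {1..N} \<le> 2 * (2 * (n + 1) + (sum r {1..n+1} - 1) + k) + 1"
proof -
  let ?G = "Erd N l r"
  \<comment> \<open>The two line vertices contribute \<open>n + 1\<close> each, their degree
    \<open>n + 2\<close> minus one; the common point contributes its degree bound minus one; all
    pendant edges met on the way contribute at most \<open>k\<close>.\<close>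
  let ?D = "2 * (n + 1) + (sum r {1..n+1} - 1) + k"
  define E where "E i j = {Apex, Line_Vertex i j}" for i j
  define F where "F i j p = {Line_Vertex i j, Point p}" for i j p
  define \<gamma> where "\<gamma> e = c (Inl ` e)" for e
  define w where "w v = card {i. i < k \<and> a i = v}" for v
  have N: "N \<ge> 1"
    using plane by (auto simp: projective_plane_def)
  have lL: "l i \<in> L" if "i \<in> {1..N}" for i
    using l that by (auto simp: bij_betw_def)
  have lsub: "l i \<subseteq> {1..N}" and lcard: "card (l i) = n + 1" if "i \<in> {1..N}" for i
    using plane lL[OF that] by (auto simp: projective_plane_def)
  have G: "simple_graph ?G" by (rule simple_graph_Erd) (use lsub in blast)
  have meet: "\<exists>p. p \<in> l i \<and> p \<in> l j" if "i \<in> {1..N}" "j \<in> {1..N}" for i j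
  proof (cases "l i = l j")
    case True
    then show ?thesis using lcard[OF that(1)] by (metis add_is_0 all_not_in_conv card.empty one_neq_zero)
  next
    case False
    have "\<forall>A\<in>L. \<forall>B\<in>L. A \<noteq> B \<longrightarrow> (\<exists>!p. p \<in> A \<and> p \<in> B)"
      using plane by (simp add: projective_plane_def)
    with False lL[OF that(1)] lL[OF that(2)] show ?thesis by (meson ex1_implies_ex)
  qed
  have E: "E i j \<in> edges ?G" if "i \<in> {1..N}" "j \<in> {1..r i}" for i j
    using that unfolding E_def Erd_def by auto
  have F: "F i j p \<in> edges ?G" if "i \<in> {1..N}" "j \<in> {1..r i}" "p \<in> l i" for i j p
    using that unfolding F_def Erd_def by auto
  have range: "\<gamma> e \<in> {1..t}" if "e \<in> edges ?G" for e
    using col that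
    by (auto simp: cyclic_interval_coloring_def proper_edge_coloring_def attach_pendant_def \<gamma>_def)
  have near: "cyclically_near t (d + w v - 1) (\<gamma> e) (\<gamma> f)"
    if "e \<in> edges ?G" "v \<in> e" "f \<in> edges ?G" "v \<in> f" "card {g \<in> edges ?G. v \<in> g} \<le> d" for e f v d
    using cyclic_interval_coloring_attach_near[OF G col that(1-4)] that(5)
    unfolding \<gamma>_def w_def by (elim cyclically_near_mono) simp
  have nearV: "cyclically_near t (n + 1 + w (Line_Vertex i j)) (\<gamma> e) (\<gamma> f)"
    if "i \<in> {1..N}" "e \<in> edges ?G" "Line_Vertex i j \<in> e" "f \<in> edges ?G" "Line_Vertex i j \<in> f" for i j e f
  proof -
    have "finite (l i)" using lsub[OF that(1)] finite_subset by blast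
    then have "card {g \<in> edges ?G. Line_Vertex i j \<in> g} \<le> n + 2"
      using degree_Line_Vertex[where l = l and i = i and N = N] that(1) lcard[OF that(1)] by fastforce
    from near[OF that(2-5) this] show ?thesis by simp
  qed
  \<comment> \<open>Positivity allows the truncated \<open>- 1\<close> to be moved past the pendant
    count in \<open>nearP\<close>.\<close>
  have S1: "sum r {1..n+1} \<ge> 1"
  proof -
    have "r 1 \<le> sum r {1..n+1}" by (rule member_le_sum) auto
    then show ?thesis using pos[of 1] N by simp
  qed
  have degP: "card {g \<in> edges ?G. Point p \<in> g} \<le> sum r {1..n+1}" if p: "p \<in> {1..N}" for p
  proof -
    let ?A = "{i. i \<in> {1..N} \<and> p \<in> l i}"
    \<comment> \<open>Bijectivity of \<open>l\<close> turns the \<open>n + 1\<close> lines through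
      \<open>p\<close> into \<open>n + 1\<close> indices, whose values sum to at most the
      \<open>n + 1\<close> largest.\<close>
    have "l ` ?A = {A \<in> L. p \<in> A}" using l by (auto simp: bij_betw_def)
    moreover have "inj_on l ?A"
      using l by (elim bij_betw_imp_inj_on[THEN inj_on_subset]) blast
    ultimately have "card ?A = card {A \<in> L. p \<in> A}" using card_image by fastforce
    also have "\<dots> = n + 1" using plane p by (simp add: projective_plane_def)
    finally have "card ?A = n + 1" .
    moreover have "sum r ?A \<le> sum r {1..card ?A}"
      by (rule sum_le_sum_initial[OF mono]) auto
    ultimately show ?thesis
      using degree_Point[of N l r p] by simp
  qed
  have nearP: "cyclically_near t (sum r {1..n+1} - 1 + w (Point p)) (\<gamma> e) (\<gamma> f)"
    if "p \<in> {1..N}" "e \<in> edges ?G" "Point p \<in> e" "f \<in> edges ?G" "Point p \<in> f" for p e f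
    using near[OF that(2-5) degP[OF that(1)]] S1 by simp
  \<comment> \<open>Pendant edges at distinct vertices are distinct, so \<open>k\<close> enters the
    total only once and not once per corner.\<close>
  have w3: "w x + w y + w z \<le> k" if "x \<noteq> y" "y \<noteq> z" "x \<noteq> z" for x y z
  proof -
    have "w x + w y + w z = card ({i. i < k \<and> a i = x} \<union> {i. i < k \<and> a i = y} \<union> {i. i < k \<and> a i = z})"
      unfolding w_def using that by (subst card_Un_disjoint, auto)+
    also have "\<dots> \<le> card {..<k}" by (rule card_mono) auto
    finally show ?thesis by simp
  qed
  have apex: "cyclically_near t ?D (\<gamma> (E i j)) (\<gamma> (E i' j'))"
    if i: "i \<in> {1..N}" "j \<in> {1..r i}" and i': "i' \<in> {1..N}" "j' \<in> {1..r i'}" for i j i' j'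
  \<comment> \<open>For equal edges the two line vertices coincide and \<open>w3\<close> does not
    apply, but the distance is zero. Distinct line vertices may still belong to the same line; any
    of its points then serves as \<open>p\<close>.\<close>
  proof (cases "(i, j) = (i', j')")
    case True
    then show ?thesis by (simp add: cyclically_near_def)
  next
    case False
    obtain p where p: "p \<in> l i" "p \<in> l i'" using meet i i' by blast
    have pN: "p \<in> {1..N}" using p lsub i by blast
    note e = E[OF i] F[OF i p(1)] E[OF i'] F[OF i' p(2)]
    have "cyclically_near t (n + 1 + w (Line_Vertex i j)) (\<gamma> (E i j)) (\<gamma> (F i j p))"
      using i e by (intro nearV) (auto simp: E_def F_def)
    moreover have "cyclically_near t (sum r {1..n+1} - 1 + w (Point p)) (\<gamma> (F i j p)) (\<gamma> (F i' j' p))"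
      using pN e by (intro nearP) (auto simp: F_def)
    moreover have "cyclically_near t (n + 1 + w (Line_Vertex i' j')) (\<gamma> (F i' j' p)) (\<gamma> (E i' j'))"
      using i' e by (intro nearV) (auto simp: E_def F_def)
    ultimately have "cyclically_near t (n + 1 + w (Line_Vertex i j) +
        (sum r {1..n+1} - 1 + w (Point p)) + (n + 1 + w (Line_Vertex i' j'))) (\<gamma> (E i j)) (\<gamma> (E i' j'))"
      using range[OF e(1)] range[OF e(2)] range[OF e(3)] range[OF e(4)] by (meson cyclically_near_trans)
    moreover have "w (Line_Vertex i j) + w (Point p) + w (Line_Vertex i' j') \<le> k"
      using False by (intro w3) auto
    ultimately show ?thesis by (elim cyclically_near_mono) simp
  qed
  let ?I = "SIGMA i:{1..N}. {1..r i}"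
  \<comment> \<open>All these edges share the apex, so properness gives them distinct colors,
    \<open>sum r {1..N}\<close> in total.\<close>
  have "inj_on (\<lambda>(i, j). \<gamma> (E i j)) ?I"
  proof (rule inj_onI, clarify)
    fix i j i' j'
    assume ij: "i \<in> {1..N}" "j \<in> {1..r i}" and ij': "i' \<in> {1..N}" "j' \<in> {1..r i'}"
      and eq: "\<gamma> (E i j) = \<gamma> (E i' j')"
    have "Inl ` E i j \<in> edges (attach_pendant ?G k a)" "Inl ` E i' j' \<in> edges (attach_pendant ?G k a)"
      using E[OF ij] E[OF ij'] by (auto simp: attach_pendant_def)
    moreover have "(Inl ` E i j \<inter> Inl ` E i' j' :: (erd_vertex + nat) set) \<noteq> {}"
      by (auto simp: E_def)
    moreover have "e = f"
      if "e \<in> edges (attach_pendant ?G k a)" "f \<in> edges (attach_pendant ?G k a)"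
        "e \<inter> f \<noteq> {}" "c e = c f" for e f
      using col that unfolding cyclic_interval_coloring_def proper_edge_coloring_def by metis
    ultimately have "(Inl ` E i j :: (erd_vertex + nat) set) = Inl ` E i' j'"
      using eq unfolding \<gamma>_def by metis
    then have "E i j = E i' j'" by (simp add: inj_image_eq_iff)
    then show "i = i' \<and> j = j'" by (auto simp: E_def doubleton_eq_iff)
  qed
  then have card_I: "card ((\<lambda>(i, j). \<gamma> (E i j)) ` ?I) = sum r {1..N}"
    by (simp add: card_image)
  \<comment> \<open>The edge \<open>E 1 1\<close> exists because \<open>r 1\<close> is positive; its
    color is the center of the ball.\<close>
  have one: "1 \<in> {1..N}" "1 \<in> {1..r 1}" using N pos[of 1] by auto
  have "(\<lambda>(i, j). \<gamma> (E i j)) ` ?I \<subseteq> {y \<in> {1..t}. cyclically_near t ?D (\<gamma> (E 1 1)) y}"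
  proof (clarify, intro conjI)
    fix i j assume ij: "i \<in> {1..N}" "j \<in> {1..r i}"
    show "\<gamma> (E i j) \<in> {1..t}" by (rule range[OF E[OF ij]])
    show "cyclically_near t ?D (\<gamma> (E 1 1)) (\<gamma> (E i j))" by (rule apex[OF one ij])
  qed
  then have "card ((\<lambda>(i, j). \<gamma> (E i j)) ` ?I)
      \<le> card {y \<in> {1..t}. cyclically_near t ?D (\<gamma> (E 1 1)) y}"
    by (intro card_mono) auto
  also have "\<dots> \<le> 2 * ?D + 1"
    by (rule card_cyclic_ball[OF range[OF E[OF one]]])
  finally show ?thesis unfolding card_I .
qed

theorem theorem13:
  fixes n N :: nat and L :: "nat set set" and l :: "nat \<Rightarrow> nat set" and r :: "nat \<Rightarrow> nat"
  assumes "n \<ge> 2" and "N = n^2 + n + 1"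
    and "projective_plane n {1..N} L"
    and "bij_betw l {1..N} L"
    and "\<And>i. i \<in> {1..N} \<Longrightarrow> r i > 0"
    and "\<And>i j. 1 \<le> i \<Longrightarrow> i \<le> j \<Longrightarrow> j \<le> N \<Longrightarrow> r i \<ge> r j"
  shows "real (cyclic_deficiency (Erd N l r)) \<ge>
    1 / 10 * ((\<Sum>i=n+2..N. real (r i)) - 9 * (\<Sum>i=1..n+1. real (r i)) + 9)"
proof -
  let ?G = "Erd N l r"
  let ?k = "cyclic_deficiency ?G"
  let ?S = "sum r {1..n+1}"
  have "l i \<subseteq> {1..N}" if "i \<in> {1..N}" for i
    using assms(3,4) that by (auto simp: projective_plane_def bij_betw_def)
  then have "simple_graph ?G" by (rule simple_graph_Erd)
  \<comment> \<open>Since some completion exists, the minimum is attained by a coloring with exactly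
    \<open>?k\<close> pendant edges.\<close>
  from LeastI_ex[OF pendant_completion[OF this]] obtain a t c
    where "cyclic_interval_coloring (attach_pendant ?G ?k a) t c"
    unfolding cyclic_deficiency_def by blast
  from Erd_coloring_bound[OF assms(3-6) this]
  have bound: "sum r {1..N} \<le> 2 * (2 * (n + 1) + (?S - 1) + ?k) + 1" by simp
  have "(\<Sum>i\<in>{1..n+1}. 1) \<le> ?S"
  proof (rule sum_mono)
    fix i assume "i \<in> {1..n+1}"
    then show "1 \<le> r i" using assms(2) assms(5)[of i] by simp
  qed
  then have S: "n + 1 \<le> ?S" by simp
  have "{1..N} = {1..n+1} \<union> {n+2..N}" using assms(2) by auto
  then have "sum r {1..N} = ?S + sum r {n+2..N}"
    by (simp add: sum.union_disjoint)
  \<comment> \<open>Using \<open>n + 1 \<le> s\<close>, the first bound gives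
    \<open>b + 9 \<le> 5 * s + 2 * k + 8\<close>; the \<open>8\<close> is absorbed by
    \<open>4 * s\<close> because \<open>s \<ge> 3\<close>. The case split on \<open>s\<close>
    resolves the truncated \<open>s - 1\<close>.\<close>
  moreover have "b + 9 \<le> 10 * k + 9 * s"
    if "a \<le> 2 * (2 * (n + 1) + (s - 1) + k) + 1" "n + 1 \<le> s" "a = s + b" for a b s k
    using that assms(1) by (cases s) simp_all
  ultimately have "sum r {n+2..N} + 9 \<le> 10 * ?k + 9 * ?S" using bound S by blast
  then have "real (sum r {n+2..N} + 9) \<le> real (10 * ?k + 9 * ?S)"
    by (rule of_nat_mono)
  then show ?thesis by simp
qed

end
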